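(* Let $K$ be a positive integer, $\mathcal{H}$ a non-empty collection of graphs, and $G$ a graph that has no $K$-fat $H$ minor for every $H \in \mathcal{H}$. Then $G$ is $K$-quasi-isometric to a graph $\widehat{G}$ that does not contain a $3$-fat $H$ minor for each $H \in \mathcal{H}$.
   Context: Graphs are metric spaces in which each edge is an arc of length one; $\dist_G(X,Y)$ denotes the infimum of lengths of paths with one end in $X$ and the other in $Y$. A set of points is path-connected if any two of its points are joined by a path inside it. For a positive integer $K$, a $K$-fat minor model of a graph $H$ in $G$ is a collection $(B_v \colon v \in V(H)) \cup (P_e \colon e\in E(H))$ of path-connected sets in $G$ such that $B_v\cap P_e\neq\emptyset$ whenever $v$ is an end of $e$ in $H$, and for any other pair of distinct sets $X,Y$ in the collection, $\dist_G(X,Y)\ge K$; $H$ is a $K$-fat minor of $G$ if such a model exists. For $q\in\mathbb{N}$, a $q$-quasi-isometry of a graph $G$ into a graph $\widehat G$ is a map $\phi\colon G\to V(\widehat G)$ with $q^{-1}\dist_G(x,y)-q\le \dist_{\widehat G}(\phi(x),\phi(y))\le q\dist_G(x,y)+q$ for all $x,y$, and such that every point of $\widehat G$ is within distance $q$ of some $\phi(v)$. *)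

theory Defs
  imports "HOL-Analysis.Analysis"
begin

text \<open>Graphs are simple and undirected; they may be infinite and disconnected.\<close>

record 'a graph =
  verts :: "'a set"
  edges :: "'a set set"

definition simple_graph :: "'a graph \<Rightarrow> bool" where
  "simple_graph G \<longleftrightarrow>
     (\<forall>e\<in>edges G. \<exists>u v. u \<in> verts G \<and> v \<in> verts G \<and> u \<noteq> v \<and> e = {u, v})"

text \<open>The points of the geometric realization are given by barycentric coordinates: a vertex
  \<open>v\<close> is the indicator function of \<open>{v}\<close>, and the point at distance \<open>t\<close> from
  \<open>u\<close> on the edge \<open>{u, v}\<close> takes the value \<open>1 - t\<close> at \<open>u\<close>,
  \<open>t\<close> at \<open>v\<close> and \<open>0\<close> elsewhere.\<close>

type_synonym 'a point = "'a \<Rightarrow> real"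

definition vpoint :: "'a \<Rightarrow> 'a point" where
  "vpoint v = (\<lambda>w. if w = v then 1 else 0)"

definition edge_points :: "'a set \<Rightarrow> 'a point set" where
  "edge_points e = {x. (\<forall>v. 0 \<le> x v) \<and> (\<forall>v. v \<notin> e \<longrightarrow> x v = 0) \<and> (\<Sum>v\<in>e. x v) = 1}"

definition points :: "'a graph \<Rightarrow> 'a point set" where
  "points G = vpoint ` verts G \<union> (\<Union>e\<in>edges G. edge_points e)"

text \<open>The length of the segment between two points of a common edge, see
  \<open>seg_length_edge\<close> below.\<close>

definition seg_length :: "'a point \<Rightarrow> 'a point \<Rightarrow> real" where
  "seg_length x y = (\<Sum>v | x v \<noteq> y v. \<bar>x v - y v\<bar>) / 2"

lemma edge_points_doubleton:
  assumes "u \<noteq> v"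
  shows "edge_points {u, v} =
    (\<lambda>t w. if w = u then 1 - t else if w = v then t else 0) ` {0..1}"
proof (intro equalityI subsetI)
  fix x assume x: "x \<in> edge_points {u, v}"
  then have "x u + x v = 1" "0 \<le> x u" "0 \<le> x v"
    using assms by (auto simp: edge_points_def)
  moreover have "x w = 0" if "w \<noteq> u" "w \<noteq> v" for w
    using x that by (auto simp: edge_points_def)
  ultimately show "x \<in> (\<lambda>t w. if w = u then 1 - t else if w = v then t else 0) ` {0..1}"
    by (intro image_eqI[of _ _ "x v"]) (auto simp: fun_eq_iff)
qed (use assms in \<open>auto simp: edge_points_def\<close>)

lemma seg_length_edge:
  assumes "u \<noteq> v"
  shows "seg_length (\<lambda>w. if w = u then 1 - s else if w = v then s else 0)
                    (\<lambda>w. if w = u then 1 - t else if w = v then t else 0) = \<bar>s - t\<bar>"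
proof (cases "s = t")
  case False
  then have "{w. (if w = u then 1 - s else if w = v then s else 0) \<noteq>
                 (if w = u then 1 - t else if w = v then t else 0)} = {u, v}"
    using assms by auto
  then show ?thesis
    using assms by (simp add: seg_length_def)
qed (simp add: seg_length_def)

text \<open>As usual for metric graphs, the length metric is defined through piecewise linear paths,
  that is, finite concatenations of segments each of which lies in a single (closed) edge; such a
  path is recorded as the list of its break points.  The distance is infinite
  if no path exists.\<close>

definition pl_path :: "'a graph \<Rightarrow> 'a point list \<Rightarrow> bool" where
  "pl_path G ps \<longleftrightarrow> ps \<noteq> [] \<and> set ps \<subseteq> points G \<and>
     successively (\<lambda>x y. \<exists>e\<in>edges G. x \<in> edge_points e \<and> y \<in> edge_points e) ps"

fun pl_length :: "'a point list \<Rightarrow> real" where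
  "pl_length (x # y # ps) = seg_length x y + pl_length (y # ps)"
| "pl_length _ = 0"

definition set_dist :: "'a graph \<Rightarrow> 'a point set \<Rightarrow> 'a point set \<Rightarrow> ereal" where
  "set_dist G X Y =
     (INF ps \<in> {ps. pl_path G ps \<and> hd ps \<in> X \<and> last ps \<in> Y}. ereal (pl_length ps))"

abbreviation point_dist :: "'a graph \<Rightarrow> 'a point \<Rightarrow> 'a point \<Rightarrow> ereal" where
  "point_dist G x y \<equiv> set_dist G {x} {y}"

text \<open>The topology induced by the (extended) metric \<^const>\<open>point_dist\<close>.\<close>

definition graph_topology :: "'a graph \<Rightarrow> 'a point topology" where
  "graph_topology G = topology (\<lambda>U. U \<subseteq> points G \<and>
     (\<forall>x\<in>U. \<exists>r>0. \<forall>y\<in>points G. point_dist G x y < ereal r \<longrightarrow> y \<in> U))"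

lemma openin_graph_topology:
  "openin (graph_topology G) U \<longleftrightarrow> U \<subseteq> points G \<and>
     (\<forall>x\<in>U. \<exists>r>0. \<forall>y\<in>points G. point_dist G x y < ereal r \<longrightarrow> y \<in> U)"
proof -
  let ?P = "\<lambda>U. \<forall>x\<in>U. \<exists>r>0. \<forall>y\<in>points G. point_dist G x y < ereal r \<longrightarrow> y \<in> U"
  have "?P (S \<inter> T)" if S: "?P S" and T: "?P T" for S T
  proof
    fix x assume "x \<in> S \<inter> T"
    then obtain r s where "r > 0" "s > 0"
      "\<forall>y\<in>points G. point_dist G x y < ereal r \<longrightarrow> y \<in> S"
      "\<forall>y\<in>points G. point_dist G x y < ereal s \<longrightarrow> y \<in> T"
      using S T by blast
    then show "\<exists>r>0. \<forall>y\<in>points G. point_dist G x y < ereal r \<longrightarrow> y \<in> S \<inter> T"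
      by (intro exI[of _ "min r s"])
        (metis IntI ereal_less_eq(3) min.cobounded1 min.cobounded2 min_less_iff_conj
          order_less_le_trans)
  qed
  moreover have "?P (\<Union>\<K>)" if "\<forall>U\<in>\<K>. ?P U" for \<K>
    using that by (meson UnionE UnionI)
  ultimately have "istopology (\<lambda>U. U \<subseteq> points G \<and> ?P U)"
    unfolding istopology_def by (smt (verit) Sup_least le_infI1)
  then show ?thesis
    by (simp add: graph_topology_def topology_inverse')
qed

lemma topspace_graph_topology: "topspace (graph_topology G) = points G"
proof -
  have "openin (graph_topology G) (points G)"
    unfolding openin_graph_topology using zero_less_one by blast
  then show ?thesis
    by (meson openin_graph_topology openin_subset openin_topspace subset_antisym)
qed

text \<open>The sets of a model are indexed by the vertices and edges of \<open>H\<close>, so ``distinct''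
  refers to the indices.  Branch sets are non-empty, as usual for minors; this matters only for
  isolated vertices of \<open>H\<close>.\<close>

definition fat_minor_model ::
  "nat \<Rightarrow> 'b graph \<Rightarrow> 'a graph \<Rightarrow> ('b \<Rightarrow> 'a point set) \<Rightarrow> ('b set \<Rightarrow> 'a point set) \<Rightarrow> bool" where
  "fat_minor_model K H G B P \<longleftrightarrow>
     (\<forall>v\<in>verts H. B v \<noteq> {} \<and> path_connectedin (graph_topology G) (B v)) \<and>
     (\<forall>e\<in>edges H. path_connectedin (graph_topology G) (P e)) \<and>
     (\<forall>e\<in>edges H. \<forall>v\<in>e. B v \<inter> P e \<noteq> {}) \<and>
     (\<forall>u\<in>verts H. \<forall>v\<in>verts H. u \<noteq> v \<longrightarrow> ereal (real K) \<le> set_dist G (B u) (B v)) \<and>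
     (\<forall>e\<in>edges H. \<forall>f\<in>edges H. e \<noteq> f \<longrightarrow> ereal (real K) \<le> set_dist G (P e) (P f)) \<and>
     (\<forall>v\<in>verts H. \<forall>e\<in>edges H. v \<notin> e \<longrightarrow> ereal (real K) \<le> set_dist G (B v) (P e))"

definition fat_minor :: "nat \<Rightarrow> 'b graph \<Rightarrow> 'a graph \<Rightarrow> bool" where
  "fat_minor K H G \<longleftrightarrow> (\<exists>B P. fat_minor_model K H G B P)"

definition quasi_isometry :: "nat \<Rightarrow> 'a graph \<Rightarrow> 'c graph \<Rightarrow> ('a point \<Rightarrow> 'c) \<Rightarrow> bool" where
  "quasi_isometry q G G' \<phi> \<longleftrightarrow>
     \<phi> ` points G \<subseteq> verts G' \<and>
     (\<forall>x\<in>points G. \<forall>y\<in>points G.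
        ereal (inverse (real q)) * point_dist G x y - ereal (real q)
          \<le> point_dist G' (vpoint (\<phi> x)) (vpoint (\<phi> y)) \<and>
        point_dist G' (vpoint (\<phi> x)) (vpoint (\<phi> y))
          \<le> ereal (real q) * point_dist G x y + ereal (real q)) \<and>
     (\<forall>z\<in>points G'. \<exists>x\<in>points G. point_dist G' z (vpoint (\<phi> x)) \<le> ereal (real q))"

definition quasi_isometric :: "nat \<Rightarrow> 'a graph \<Rightarrow> 'c graph \<Rightarrow> bool" where
  "quasi_isometric q G G' \<longleftrightarrow> (\<exists>\<phi>. quasi_isometry q G G' \<phi>)"

end

theory Submission
  imports Defs
begin

text \<open>Take for \<open>G'\<close> the \<open>K\<close>-th power of \<open>G\<close>.  A set \<open>X\<close> of a \<open>3\<close>-fat model in \<open>G'\<close> is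
  replaced by the union of the balls of radius \<open>(K + 1) / 2\<close> in \<open>G\<close> around the vertices at
  distance less than \<open>1/2\<close> from \<open>X\<close>.  Such vertices for two sets at distance at least \<open>3\<close> have
  distance more than \<open>2\<close> in \<open>G'\<close>, hence at least \<open>2 K + 1\<close> in \<open>G\<close>, so the balls are \<open>K\<close> apart;
  and balls around adjacent vertices of \<open>G'\<close> meet, which gives path-connectedness and the required
  intersections.  The exception is a set consisting of the midpoint of an edge only, which has no such
  vertices.  It must be a branch set of a vertex of degree at most one, and is replaced by a single
  end of that edge, chosen close to the incident path if there is one.\<close>

section \<open>Walks and paths of prescribed length\<close>

text \<open>Kept as a relation so that walks with \<open>n\<close> edges are the pairs in the
  relational power \<open>adj G ^^ n\<close>.\<close>

definition adj :: "'a graph \<Rightarrow> ('a \<times> 'a) set" where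
  "adj G = {(u, v). {u, v} \<in> edges G}"

text \<open>An inductive form of \<open>pl_path\<close> that carries the length along: induction
  splits off the last segment, and infinite distance is just the absence of any real
  \<open>L\<close>.\<close>

inductive pl_joined :: "'a graph \<Rightarrow> 'a point \<Rightarrow> real \<Rightarrow> 'a point \<Rightarrow> bool" for G x where
  refl: "x \<in> points G \<Longrightarrow> pl_joined G x 0 x"
| step: "pl_joined G x L y \<Longrightarrow> e \<in> edges G \<Longrightarrow> y \<in> edge_points e \<Longrightarrow> z \<in> edge_points e \<Longrightarrow>
    pl_joined G x (L + seg_length y z) z"

section \<open>Barycentric coordinates and segment lengths\<close>

lemma simple_graph_edgeE:
  assumes "simple_graph G" "e \<in> edges G"
  obtains u v where "u \<in> verts G" "v \<in> verts G" "u \<noteq> v" "e = {u, v}"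
  using assms by (auto simp: simple_graph_def)

lemma edge_points_subset_points: "e \<in> edges G \<Longrightarrow> edge_points e \<subseteq> points G"
  by (auto simp: points_def)

lemma vpoint_in_points: "v \<in> verts G \<Longrightarrow> vpoint v \<in> points G"
  by (auto simp: points_def)

lemma edge_points_pairD:
  assumes "x \<in> edge_points {u, v}" "u \<noteq> v"
  shows "x u + x v = 1" "0 \<le> x u" "0 \<le> x v" "w \<noteq> u \<Longrightarrow> w \<noteq> v \<Longrightarrow> x w = 0"
  using assms by (auto simp: edge_points_def)

lemma points_cases:
  assumes "simple_graph G" "x \<in> points G"
  obtains v where "v \<in> verts G" "x = vpoint v"
  | u v where "u \<in> verts G" "v \<in> verts G" "u \<noteq> v" "{u, v} \<in> edges G" "x \<in> edge_points {u, v}"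
proof -
  consider v where "v \<in> verts G" "x = vpoint v" | e where "e \<in> edges G" "x \<in> edge_points e"
    using assms(2) by (auto simp: points_def)
  then show thesis
  proof cases
    case (2 e)
    then show thesis using simple_graph_edgeE[OF assms(1) 2(1)] that(2) by metis
  qed (use that(1) in blast)
qed

lemma points_pos_in_verts:
  assumes "simple_graph G" "x \<in> points G" "x v > 0"
  shows "v \<in> verts G"
  using assms(1,2)
proof (cases rule: points_cases)
  case (1 w)
  then show ?thesis using assms(3) by (auto simp: vpoint_def split: if_splits)
next
  case (2 u w)
  then show ?thesis using assms(3) edge_points_pairD(4)[OF 2(5,3), of v] by auto
qed

text \<open>The support of a point is a single vertex or lies within one edge. This is how adjacency
  of vertices is later read off from a point close to both.\<close>

lemma points_two_pos:
  assumes "simple_graph G" "x \<in> points G" "x a > 0" "x b > 0" "a \<noteq> b"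
  shows "{a, b} \<in> edges G" "x \<in> edge_points {a, b}"
proof -
  have "{a, b} \<in> edges G \<and> x \<in> edge_points {a, b}"
    using assms(1,2)
  proof (cases rule: points_cases)
    case (1 w)
    then show ?thesis using assms(3-5) by (auto simp: vpoint_def split: if_splits)
  next
    case (2 u w)
    then have "{a, b} = {u, w}"
      using assms(3-5) edge_points_pairD(4)[OF 2(5,3)] by (metis insert_commute less_irrefl)
    then show ?thesis using 2 by simp
  qed
  then show "{a, b} \<in> edges G" "x \<in> edge_points {a, b}" by auto
qed

lemma points_half:
  assumes "simple_graph G" "x \<in> points G"
  obtains v where "v \<in> verts G" "x v \<ge> 1/2"
  using assms
proof (cases rule: points_cases)
  case (1 w)
  then show ?thesis using that[of w] by (auto simp: vpoint_def)
next
  case (2 u w)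
  then show ?thesis using that[of u] that[of w] edge_points_pairD(1)[OF 2(5,3)] by linarith
qed

lemma vpoint_in_edge_points:
  assumes "v \<in> e" "finite e"
  shows "vpoint v \<in> edge_points e"
  using assms by (auto simp: edge_points_def vpoint_def)

lemma seg_length_pair:
  assumes "u \<noteq> v" "x \<in> edge_points {u, v}" "y \<in> edge_points {u, v}"
  shows "seg_length x y = \<bar>x u - y u\<bar>"
proof -
  obtain s t where "x = (\<lambda>w. if w = u then 1 - s else if w = v then s else 0)"
      "y = (\<lambda>w. if w = u then 1 - t else if w = v then t else 0)"
    using assms edge_points_doubleton[OF assms(1)] by auto
  then show ?thesis using seg_length_edge[OF assms(1)] by simp
qed

lemma seg_length_commute: "seg_length x y = seg_length y x"
proof -
  have "{v. x v \<noteq> y v} = {v. y v \<noteq> x v}" by auto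
  then show ?thesis by (simp add: seg_length_def abs_minus_commute)
qed

lemma seg_length_nonneg: "0 \<le> seg_length x y"
  by (simp add: seg_length_def sum_nonneg)

text \<open>The two coordinates on an edge sum to 1, so both change by the same amount along a
  segment, while all other coordinates stay 0.\<close>

lemma seg_length_coord:
  assumes "simple_graph G" "e \<in> edges G" "x \<in> edge_points e" "y \<in> edge_points e"
  shows "\<bar>x v - y v\<bar> \<le> seg_length x y"
    and "v \<in> e \<Longrightarrow> seg_length x y = \<bar>x v - y v\<bar>"
proof -
  obtain a b where ab: "a \<noteq> b" "e = {a, b}" using assms simple_graph_edgeE by metis
  note x = edge_points_pairD[OF assms(3)[unfolded ab(2)] ab(1)]
  note y = edge_points_pairD[OF assms(4)[unfolded ab(2)] ab(1)]
  have s: "seg_length x y = \<bar>x a - y a\<bar>"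
    using seg_length_pair assms ab by metis
  have "\<bar>x a - y a\<bar> = \<bar>x b - y b\<bar>" using x(1) y(1) by linarith
  then show "v \<in> e \<Longrightarrow> seg_length x y = \<bar>x v - y v\<bar>" using s ab by auto
  then show "\<bar>x v - y v\<bar> \<le> seg_length x y"
    using x(4)[of v] y(4)[of v] ab seg_length_nonneg[of x y] by (cases "v \<in> e") auto
qed

section \<open>Calculus of joining paths, distances and open balls\<close>

lemma pl_joined_in_points:
  assumes "pl_joined G x L y"
  shows "x \<in> points G" "y \<in> points G"
  using assms by induction (use edge_points_subset_points in blast)+

lemma pl_joined_nonneg: "pl_joined G x L y \<Longrightarrow> 0 \<le> L"
  by (induction rule: pl_joined.induct) (auto intro: add_nonneg_nonneg seg_length_nonneg)

lemma pl_joined_trans: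
  assumes "pl_joined G y M z" "pl_joined G x L y"
  shows "pl_joined G x (L + M) z"
  using assms
proof induction
  case refl
  then show ?case by simp
next
  case (step M y' e z)
  then show ?case using pl_joined.step[of G x "L + M" y' e z] by (simp add: add.assoc)
qed

lemma pl_joined_edge:
  assumes "e \<in> edges G" "x \<in> edge_points e" "y \<in> edge_points e"
  shows "pl_joined G x (seg_length x y) y"
  using pl_joined.step[OF pl_joined.refl, of x G e y] assms edge_points_subset_points by fastforce

lemma pl_joined_sym: "pl_joined G x L y \<Longrightarrow> pl_joined G y L x"
proof (induction rule: pl_joined.induct)
  case refl
  then show ?case by (rule pl_joined.refl)
next
  case (step L y e z)
  then show ?case
    using pl_joined_trans[OF step.IH pl_joined_edge[OF step.hyps(2,4,3)]]
    by (simp add: seg_length_commute add.commute)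
qed

text \<open>Adding up the segments makes each coordinate 1-Lipschitz. In particular a coordinate of
  at least 1/2 stays positive along paths shorter than 1/2.\<close>

lemma pl_joined_coord:
  assumes "simple_graph G" "pl_joined G x L y"
  shows "\<bar>x v - y v\<bar> \<le> L"
  using assms(2)
proof induction
  case (step L y e z)
  then show ?case using seg_length_coord(1)[OF assms(1) step.hyps(2-4), of v] by linarith
qed simp

lemma pl_length_snoc: "ps \<noteq> [] \<Longrightarrow> pl_length (ps @ [z]) = pl_length ps + seg_length (last ps) z"
  by (induction ps rule: pl_length.induct) auto

lemma pl_path_snoc:
  "ps \<noteq> [] \<Longrightarrow> pl_path G (ps @ [z]) \<longleftrightarrow>
    pl_path G ps \<and> (\<exists>e\<in>edges G. last ps \<in> edge_points e \<and> z \<in> edge_points e)"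
  using edge_points_subset_points[of _ G]
  by (auto simp: pl_path_def successively_append_iff)

lemma pl_joined_iff:
  "pl_joined G x L y \<longleftrightarrow> (\<exists>ps. pl_path G ps \<and> hd ps = x \<and> last ps = y \<and> pl_length ps = L)"
proof
  assume "pl_joined G x L y"
  then show "\<exists>ps. pl_path G ps \<and> hd ps = x \<and> last ps = y \<and> pl_length ps = L"
  proof induction
    case refl
    then show ?case by (intro exI[of _ "[x]"]) (auto simp: pl_path_def)
  next
    case (step L y e z)
    then obtain ps where ps: "pl_path G ps" "hd ps = x" "last ps = y" "pl_length ps = L" by auto
    then have "ps \<noteq> []" by (auto simp: pl_path_def)
    then show ?case using ps step.hyps
      by (intro exI[of _ "ps @ [z]"]) (auto simp: pl_path_snoc pl_length_snoc)
  qed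
next
  assume "\<exists>ps. pl_path G ps \<and> hd ps = x \<and> last ps = y \<and> pl_length ps = L"
  then obtain ps where "pl_path G ps" "hd ps = x" "last ps = y" "pl_length ps = L" by auto
  then show "pl_joined G x L y"
  proof (induction ps arbitrary: y L rule: rev_induct)
    case Nil
    then show ?case by (simp add: pl_path_def)
  next
    case (snoc z ps)
    show ?case
    proof (cases "ps = []")
      case True
      then show ?thesis using snoc.prems by (auto simp: pl_path_def intro: pl_joined.refl)
    next
      case False
      then show ?thesis using snoc.prems snoc.IH[OF _ _ HOL.refl HOL.refl]
        by (auto simp: pl_path_snoc pl_length_snoc intro: pl_joined.step)
    qed
  qed
qed

text \<open>Lower bounds on an infimum can be tested path by path, which replaces extended reals by
  real lengths, also when no path exists.\<close>

lemma le_set_dist_iff: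
  "ereal c \<le> set_dist G X Y \<longleftrightarrow> (\<forall>x\<in>X. \<forall>y\<in>Y. \<forall>L. pl_joined G x L y \<longrightarrow> c \<le> L)"
  by (auto simp: set_dist_def le_INF_iff pl_joined_iff)

lemma point_dist_le: "pl_joined G x L y \<Longrightarrow> point_dist G x y \<le> ereal L"
  by (auto simp: set_dist_def pl_joined_iff intro!: INF_lower2)

lemma point_dist_less_iff: "point_dist G x y < c \<longleftrightarrow> (\<exists>L. pl_joined G x L y \<and> ereal L < c)"
  by (auto simp: set_dist_def INF_less_iff pl_joined_iff)

lemma openin_graph_ball:
  "openin (graph_topology G) {y \<in> points G. point_dist G x y < ereal r}"
  unfolding openin_graph_topology
proof (intro conjI ballI)
  fix y assume "y \<in> {y \<in> points G. point_dist G x y < ereal r}"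
  then obtain L where L: "pl_joined G x L y" "L < r" by (auto simp: point_dist_less_iff)
  have "point_dist G x z < ereal r" if "point_dist G y z < ereal (r - L)" for z
  proof -
    obtain M where "pl_joined G y M z" "M < r - L" using \<open>point_dist G y z < _\<close>
      by (auto simp: point_dist_less_iff)
    then show ?thesis
      using pl_joined_trans[OF _ L(1)] by (force simp: point_dist_less_iff)
  qed
  then show "\<exists>s>0. \<forall>z\<in>points G. point_dist G y z < ereal s \<longrightarrow>
      z \<in> {y \<in> points G. point_dist G x y < ereal r}"
    using L by (intro exI[of _ "r - L"]) auto
qed auto

section \<open>Paths between vertices versus walks\<close>

lemma pl_joined_vpoint:
  assumes "simple_graph G" "x \<in> points G" "x v > 0"
  shows "pl_joined G x (1 - x v) (vpoint v)"
  using assms(1,2)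
proof (cases rule: points_cases)
  case (1 w)
  then show ?thesis using assms(2,3)
    by (auto simp: vpoint_def split: if_splits intro: pl_joined.refl)
next
  case (2 a b)
  have v: "v \<in> {a, b}" using edge_points_pairD(4)[OF 2(5,3), of v] assms(3) by auto
  then have vp: "vpoint v \<in> edge_points {a, b}" by (intro vpoint_in_edge_points) auto
  have "x v \<le> 1" using v edge_points_pairD(1-3)[OF 2(5,3)] by auto
  then have "seg_length x (vpoint v) = 1 - x v"
    using seg_length_coord(2)[OF assms(1) 2(4,5) vp v] by (simp add: vpoint_def)
  then show ?thesis using pl_joined_edge[OF 2(4,5) vp] by simp
qed

lemma adj_sym: "sym (adj G)"
  by (auto simp: adj_def sym_def insert_commute)

lemma relpow_adj_sym: "(p, q) \<in> adj G ^^ n \<Longrightarrow> (q, p) \<in> adj G ^^ n"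
proof (induction n arbitrary: q)
  case (Suc n)
  then obtain r where "(p, r) \<in> adj G ^^ n" "(r, q) \<in> adj G" by auto
  then show ?case using Suc.IH adj_sym by (metis relpow_Suc_I2 symE)
qed simp

lemma adj_in_verts: "simple_graph G \<Longrightarrow> (p, q) \<in> adj G \<Longrightarrow> p \<in> verts G \<and> q \<in> verts G \<and> p \<noteq> q"
  by (fastforce simp: adj_def simple_graph_def doubleton_eq_iff)

lemma relpow_adj_in_verts:
  assumes "simple_graph G" "(p, q) \<in> adj G ^^ n" "p \<in> verts G"
  shows "q \<in> verts G"
  using assms(2) adj_in_verts[OF assms(1)] assms(3) by (cases n) auto

lemma relpow_imp_pl_joined:
  assumes "simple_graph G" "(p, q) \<in> adj G ^^ n" "p \<in> verts G"
  shows "pl_joined G (vpoint p) (real n) (vpoint q)"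
  using assms(2)
proof (induction n arbitrary: q)
  case 0
  then show ?case using assms(3) by (auto intro: pl_joined.refl vpoint_in_points)
next
  case (Suc n)
  then obtain r where r: "pl_joined G (vpoint p) (real n) (vpoint r)" "(r, q) \<in> adj G" by auto
  then have e: "{r, q} \<in> edges G" "r \<noteq> q"
    using adj_in_verts[OF assms(1)] by (auto simp: adj_def)
  have rq: "vpoint r \<in> edge_points {r, q}" "vpoint q \<in> edge_points {r, q}"
    by (auto intro: vpoint_in_edge_points)
  have "seg_length (vpoint r) (vpoint q) = 1"
    using seg_length_pair[OF e(2) rq] e(2) by (simp add: vpoint_def)
  then show ?case using pl_joined.step[OF r(1) e(1) rq] by (simp add: add.commute)
qed

text \<open>The invariant says that the path so far is at least as long as some walk from \<open>p\<close> to an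
  end \<open>v\<close> of the current edge, followed by the segment from \<open>v\<close> to the current point.\<close>

lemma pl_joined_imp_relpow:
  assumes "simple_graph G" "pl_joined G (vpoint p) L (vpoint q)"
  obtains n where "(p, q) \<in> adj G ^^ n" "real n \<le> L"
proof -
  have "\<exists>n v. (p, v) \<in> adj G ^^ n \<and> y v > 0 \<and> real n + (1 - y v) \<le> L"
    if "pl_joined G (vpoint p) L y" for y L
    using that
  proof induction
    case refl
    show ?case by (intro exI[of _ 0] exI[of _ p]) (auto simp: vpoint_def)
  next
    case (step L y e z)
    then obtain n v where v: "(p, v) \<in> adj G ^^ n" "y v > 0" "real n + (1 - y v) \<le> L" by auto
    then have "v \<in> e" using step.hyps(3) by (force simp: edge_points_def)
    then obtain w where w: "w \<noteq> v" "e = {v, w}"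
      using simple_graph_edgeE[OF assms(1) step.hyps(2)] by (metis doubleton_eq_iff insertE singletonD)
    have s: "seg_length y z = \<bar>y v - z v\<bar>"
      using seg_length_coord(2)[OF assms(1) step.hyps(2-4) \<open>v \<in> e\<close>] .
    show ?case
    proof (cases "z v > 0")
      case True
      then show ?thesis using v s by (intro exI[of _ n] exI[of _ v]) auto
    next
      case False
      \<comment> \<open>The segment has run to the other end \<open>w\<close>. Together with the
        earlier part \<open>1 - y v\<close> its length \<open>y v\<close> makes up one full edge, so
        the walk is extended by one step.\<close>
      then have "z v = 0" "z w = 1"
        using step.hyps(4) w edge_points_pairD[of z v w] by auto
      moreover have "(p, w) \<in> adj G ^^ Suc n"
        using v(1) step.hyps(2) w by (auto simp: adj_def)
      ultimately show ?thesis using v s by (intro exI[of _ "Suc n"] exI[of _ w]) auto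
    qed
  qed
  from this[OF assms(2)] show ?thesis using that by (auto simp: vpoint_def split: if_splits)
qed

section \<open>Continuity of segments and path-connectedness of balls\<close>

lemma edge_points_convex:
  assumes "x \<in> edge_points e" "y \<in> edge_points e" "t \<in> {0..1}"
  shows "(\<lambda>v. (1 - t) * x v + t * y v) \<in> edge_points e"
  using assms by (auto simp: edge_points_def sum.distrib simp flip: sum_distrib_left)

text \<open>Coordinates lie between 0 and 1, so the affine parametrization is 1-Lipschitz for the
  path distance and hence continuous.\<close>

lemma segment_pathin:
  assumes "simple_graph G" "e \<in> edges G" "x \<in> edge_points e" "y \<in> edge_points e"
  defines "g \<equiv> \<lambda>t v. (1 - t) * x v + t * y v"
  shows "pathin (graph_topology G) g"
proof -
  have ge: "g t \<in> edge_points e" if "t \<in> {0..1}" for t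
    using edge_points_convex[OF assms(3,4) that] by (simp add: g_def)
  obtain a b where ab: "a \<in> e" "e = {a, b}" "a \<noteq> b"
    using simple_graph_edgeE[OF assms(1,2)] by (metis insertI1)
  have dist: "point_dist G (g t) (g s) \<le> ereal \<bar>t - s\<bar>" if "t \<in> {0..1}" "s \<in> {0..1}" for s t
  proof -
    have "\<bar>x a - y a\<bar> \<le> 1"
      using ab edge_points_pairD(1-3)[of x a b] edge_points_pairD(1-3)[of y a b] assms(3,4) by auto
    moreover have "g t a - g s a = (s - t) * (x a - y a)"
      by (simp add: g_def algebra_simps)
    then have "seg_length (g t) (g s) = \<bar>s - t\<bar> * \<bar>x a - y a\<bar>"
      using seg_length_coord(2)[OF assms(1,2) ge ge ab(1)] that by (simp add: abs_mult)
    ultimately have "seg_length (g t) (g s) \<le> \<bar>t - s\<bar>"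
      by (simp add: abs_minus_commute mult_left_le)
    then show ?thesis
      using point_dist_le[OF pl_joined_edge[OF assms(2) ge ge]] that
      by (meson ereal_less_eq(3) order_trans)
  qed
  have "openin (top_of_set {0..1}) {t \<in> {0..1}. g t \<in> U}" if U: "openin (graph_topology G) U" for U
    unfolding openin_euclidean_subtopology_iff
  proof (intro conjI ballI)
    fix t assume t: "t \<in> {t \<in> {0..1}. g t \<in> U}"
    then obtain r where r: "r > 0" "\<forall>z\<in>points G. point_dist G (g t) z < ereal r \<longrightarrow> z \<in> U"
      using U by (auto simp: openin_graph_topology)
    have "s \<in> {t \<in> {0..1}. g t \<in> U}" if "s \<in> {0..1}" "dist s t < r" for s
    proof -
      have "point_dist G (g t) (g s) < ereal r"
        using dist[of t s] t that by (force simp: dist_real_def abs_minus_commute elim: le_less_trans)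
      then show ?thesis using r ge that edge_points_subset_points[OF assms(2)] by auto
    qed
    then show "\<exists>r>0. \<forall>s\<in>{0..1}. dist s t < r \<longrightarrow> s \<in> {t \<in> {0..1}. g t \<in> U}"
      using r by blast
  qed auto
  moreover have "g t \<in> points G" if "t \<in> {0..1}" for t
    using ge[OF that] edge_points_subset_points[OF assms(2)] by auto
  ultimately show ?thesis
    by (auto simp: pathin_def continuous_map_def topspace_graph_topology Pi_def)
qed

text \<open>Membership demands an actual path of length at most \<open>r\<close>, rather than a
  bound on the infimum, so that the path can be followed inside the ball.\<close>

definition pl_cball :: "'a graph \<Rightarrow> 'a \<Rightarrow> real \<Rightarrow> 'a point set" where
  "pl_cball G p r = {z. \<exists>L\<le>r. pl_joined G (vpoint p) L z}"

lemma pl_cball_center: "p \<in> verts G \<Longrightarrow> 0 \<le> r \<Longrightarrow> vpoint p \<in> pl_cball G p r"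
  by (auto simp: pl_cball_def intro: pl_joined.refl vpoint_in_points)

text \<open>Every initial piece of a path of length at most \<open>r\<close> from the centre again
  has length at most \<open>r\<close>, so the whole path stays in the ball.\<close>

lemma path_component_of_cball:
  assumes "simple_graph G" "z \<in> pl_cball G p r" "pl_cball G p r \<subseteq> S"
  shows "path_component_of (subtopology (graph_topology G) S) (vpoint p) z"
proof -
  have "path_component_of (subtopology (graph_topology G) S) (vpoint p) z"
    if "pl_joined G (vpoint p) L z" "L \<le> r" for L z
    using that
  proof induction
    case refl
    then have "vpoint p \<in> S" using assms(3) by (auto simp: pl_cball_def intro: pl_joined.refl)
    then show ?case
      using refl by (simp add: path_component_of_refl topspace_graph_topology)
  next
    case (step L y e z)
    define g where "g \<equiv> \<lambda>t v. (1 - t) * y v + t * z v"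
    have g: "pathin (graph_topology G) g"
      unfolding g_def by (rule segment_pathin[OF assms(1) step.hyps(2-4)])
    have "g t \<in> S" if t: "t \<in> {0..1}" for t
    proof -
      have gt: "g t \<in> edge_points e"
        using edge_points_convex[OF step.hyps(3,4) t] by (simp add: g_def)
      obtain a where a: "a \<in> e" using simple_graph_edgeE[OF assms(1) step.hyps(2)] by (metis insertI1)
      have "y a - g t a = t * (y a - z a)" by (simp add: g_def algebra_simps)
      then have "seg_length y (g t) = t * \<bar>y a - z a\<bar>"
        using seg_length_coord(2)[OF assms(1) step.hyps(2,3) gt a] t by (simp add: abs_mult)
      also have "\<dots> \<le> seg_length y z"
        using seg_length_coord(2)[OF assms(1) step.hyps(2-4) a] t by (simp add: mult_left_le_one_le)
      finally have "L + seg_length y (g t) \<le> r" using step.prems by linarith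
      then show ?thesis
        using pl_joined.step[OF step.hyps(1-3) gt] assms(3) by (auto simp: pl_cball_def)
    qed
    then have "pathin (subtopology (graph_topology G) S) g"
      using g by (auto simp: pathin_subtopology)
    then have "path_component_of (subtopology (graph_topology G) S) y z"
      unfolding path_component_of_def by (intro exI[of _ g]) (auto simp: g_def)
    moreover have "L \<le> r" using step.prems seg_length_nonneg[of y z] by linarith
    ultimately show ?case using step.IH path_component_of_trans by metis
  qed
  then show ?thesis using assms(2) by (auto simp: pl_cball_def)
qed

section \<open>The power graph and its quasi-isometry with the graph\<close>

definition power_graph :: "nat \<Rightarrow> 'a graph \<Rightarrow> 'a graph" where
  "power_graph K G = \<lparr>verts = verts G, edges = {{u, v} | u v. u \<in> verts G \<and> v \<in> verts G \<and> u \<noteq> v \<and>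
     (\<exists>n\<le>K. (u, v) \<in> adj G ^^ n)}\<rparr>"

lemma verts_power_graph [simp]: "verts (power_graph K G) = verts G"
  by (simp add: power_graph_def)

lemma simple_graph_power_graph: "simple_graph (power_graph K G)"
  by (auto simp: simple_graph_def power_graph_def)

lemma adj_power_graph_iff:
  "(p, q) \<in> adj (power_graph K G) \<longleftrightarrow>
    p \<in> verts G \<and> q \<in> verts G \<and> p \<noteq> q \<and> (\<exists>n\<le>K. (p, q) \<in> adj G ^^ n)"
proof -
  have "(p, q) \<in> adj (power_graph K G) \<longleftrightarrow> (\<exists>u v. {p, q} = {u, v} \<and> u \<in> verts G \<and> v \<in> verts G \<and>
      u \<noteq> v \<and> (\<exists>n\<le>K. (u, v) \<in> adj G ^^ n))"
    unfolding adj_def[of "power_graph K G"] by (simp add: power_graph_def)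
  then show ?thesis by (auto simp: doubleton_eq_iff dest: relpow_adj_sym)
qed

text \<open>Each edge of the power graph is replaced by a walk of at most \<open>K\<close>
  edges.\<close>

lemma relpow_of_power_graph:
  "(p, q) \<in> adj (power_graph K G) ^^ m \<Longrightarrow> \<exists>n\<le>K * m. (p, q) \<in> adj G ^^ n"
proof (induction m arbitrary: q)
  case (Suc m)
  then obtain r n where r: "n \<le> K * m" "(p, r) \<in> adj G ^^ n" "(r, q) \<in> adj (power_graph K G)"
    by fastforce
  then obtain n' where n': "n' \<le> K" "(r, q) \<in> adj G ^^ n'"
    by (auto simp: adj_power_graph_iff)
  have "(p, q) \<in> adj G ^^ (n + n')" using r n' by (auto simp: relpow_add)
  then show ?case using r n' by (intro exI[of _ "n + n'"]) auto
qed auto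

text \<open>The walk is cut greedily into pieces of length \<open>K\<close>. A piece that returns to
  its start gives no edge of the power graph and is dropped, hence only
  \<open>m' \<le> m\<close>.\<close>

lemma relpow_power_graph:
  assumes "simple_graph G" "(p, q) \<in> adj G ^^ n" "p \<in> verts G" "n \<le> K * m"
  shows "\<exists>m'\<le>m. (p, q) \<in> adj (power_graph K G) ^^ m'"
  using assms(2-4)
proof (induction m arbitrary: p n)
  case (Suc m)
  define i where "i = min n K"
  have "n = i + (n - i)" by (simp add: i_def)
  then obtain r where r: "(p, r) \<in> adj G ^^ i" "(r, q) \<in> adj G ^^ (n - i)"
    using Suc.prems(1) by (metis relpow_add relcompE prod.inject)
  have rv: "r \<in> verts G" using relpow_adj_in_verts[OF assms(1) r(1) Suc.prems(2)] .
  have "n - i \<le> K * m" using Suc.prems(3) by (auto simp: i_def)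
  then obtain m' where m': "m' \<le> m" "(r, q) \<in> adj (power_graph K G) ^^ m'"
    using Suc.IH[OF r(2) rv] by auto
  show ?case
  proof (cases "p = r")
    case True
    then show ?thesis using m' le_SucI by blast
  next
    case False
    then have "(p, r) \<in> adj (power_graph K G)"
      using r(1) rv Suc.prems(2) by (auto simp: adj_power_graph_iff i_def intro!: exI[of _ "min n K"])
    then have "(p, q) \<in> adj (power_graph K G) ^^ Suc m'" using m'(2) by (rule relpow_Suc_I2)
    then show ?thesis using m'(1) by (meson Suc_le_mono)
  qed
qed auto

text \<open>The map rounds a point to a vertex within distance 1/2. The two rounding errors add at
  most 1 to a distance in \<open>G\<close>, which the additive constant \<open>K \<ge> 1\<close>
  absorbs after scaling.\<close>

lemma quasi_isometric_power_graph:
  assumes "simple_graph G" "K > 0"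
  shows "quasi_isometric K G (power_graph K G)"
proof -
  let ?G' = "power_graph K G"
  have sG': "simple_graph ?G'" by (rule simple_graph_power_graph)
  define \<phi> where "\<phi> x = (SOME v. v \<in> verts G \<and> x v \<ge> 1/2)" for x :: "'a point"
  have \<phi>: "\<phi> x \<in> verts G" "x (\<phi> x) \<ge> 1/2" if "x \<in> points G" for x
    using someI_ex[of "\<lambda>v. v \<in> verts G \<and> x v \<ge> 1/2"] points_half[OF assms(1) that]
    unfolding \<phi>_def by blast+
  have \<phi>_near: "\<exists>L\<le>1/2. pl_joined G x L (vpoint (\<phi> x))" if "x \<in> points G" for x
    using pl_joined_vpoint[OF assms(1) that, of "\<phi> x"] \<phi>[OF that]
    by (intro exI[of _ "1 - x (\<phi> x)"]) auto
  have K1: "real K \<ge> 1" using assms(2) by simp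
  have lower: "ereal (inverse (real K)) * point_dist G x y - ereal (real K)
          \<le> point_dist ?G' (vpoint (\<phi> x)) (vpoint (\<phi> y))" (is "?lhs \<le> ?rhs")
    if xy: "x \<in> points G" "y \<in> points G" for x y
  proof (rule ccontr)
    assume "\<not> ?lhs \<le> ?rhs"
    then obtain L where L: "pl_joined ?G' (vpoint (\<phi> x)) L (vpoint (\<phi> y))" "ereal L < ?lhs"
      by (auto simp: point_dist_less_iff not_le)
    obtain m where m: "(\<phi> x, \<phi> y) \<in> adj ?G' ^^ m" "real m \<le> L"
      using pl_joined_imp_relpow[OF sG' L(1)] .
    obtain n where n: "n \<le> K * m" "(\<phi> x, \<phi> y) \<in> adj G ^^ n"
      using relpow_of_power_graph[OF m(1)] by auto
    have j: "pl_joined G (vpoint (\<phi> x)) (real n) (vpoint (\<phi> y))"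
      using relpow_imp_pl_joined[OF assms(1) n(2)] \<phi>(1) xy by blast
    obtain L1 L2 where L12: "L1 \<le> 1/2" "pl_joined G x L1 (vpoint (\<phi> x))"
      "L2 \<le> 1/2" "pl_joined G y L2 (vpoint (\<phi> y))" using \<phi>_near xy by blast
    have j': "pl_joined G x (L1 + (real n + L2)) y"
      using pl_joined_trans[OF pl_joined_trans[OF pl_joined_sym[OF L12(4)] j] L12(2)] .
    have "real n \<le> real K * real m" using n(1) by (metis of_nat_le_iff of_nat_mult)
    also have "\<dots> \<le> real K * L" using m(2) by (simp add: mult_left_mono)
    finally have "L1 + (real n + L2) \<le> real K * L + 1" using L12 by linarith
    then have "point_dist G x y \<le> ereal (real K * L + 1)"
      using point_dist_le[OF j'] by (meson ereal_less_eq(3) order_trans)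
    then have "ereal (inverse (real K)) * point_dist G x y \<le> ereal (inverse (real K)) * ereal (real K * L + 1)"
      by (intro ereal_mult_left_mono) auto
    also have "\<dots> = ereal (L + inverse (real K))"
      using K1 by (simp add: field_simps)
    also have "\<dots> \<le> ereal (L + real K)"
      using K1 le_imp_inverse_le[of 1 "real K"] by simp
    finally have "?lhs \<le> ereal (L + real K) - ereal (real K)"
      by (rule ereal_minus_mono) auto
    then show False using L(2) by auto
  qed
  have upper: "point_dist ?G' (vpoint (\<phi> x)) (vpoint (\<phi> y))
          \<le> ereal (real K) * point_dist G x y + ereal (real K)" (is "?lhs \<le> ?rhs")
    if xy: "x \<in> points G" "y \<in> points G" for x y
  proof (rule ccontr)
    have bound: "?lhs \<le> ereal (real K * L + real K)" if L: "pl_joined G x L y" for L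
    proof -
      obtain L1 L2 where L12: "L1 \<le> 1/2" "pl_joined G x L1 (vpoint (\<phi> x))"
        "L2 \<le> 1/2" "pl_joined G y L2 (vpoint (\<phi> y))" using \<phi>_near xy by blast
      have "pl_joined G (vpoint (\<phi> x)) (L1 + (L + L2)) (vpoint (\<phi> y))"
        using pl_joined_trans[OF pl_joined_trans[OF L12(4) L] pl_joined_sym[OF L12(2)]] .
      then obtain n where n: "(\<phi> x, \<phi> y) \<in> adj G ^^ n" "real n \<le> L1 + (L + L2)"
        using pl_joined_imp_relpow[OF assms(1)] by blast
      \<comment> \<open>Passing to the power does not lengthen walks: \<open>n\<close> edges of
        \<open>G\<close> give at most \<open>n\<close> edges of the power graph.\<close>
      have "n \<le> K * n" using assms(2) by simp
      then obtain m where m: "m \<le> n" "(\<phi> x, \<phi> y) \<in> adj ?G' ^^ m"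
        using relpow_power_graph[OF assms(1) n(1) \<phi>(1)[OF xy(1)]] by blast
      have "real m \<le> L + 1" using m(1) n(2) L12 by linarith
      also have "\<dots> \<le> real K * (L + 1)"
        using K1 pl_joined_nonneg[OF L] mult_right_mono[of 1 "real K" "L + 1"] by simp
      finally have "real m \<le> real K * L + real K" by (simp add: algebra_simps)
      moreover have "pl_joined ?G' (vpoint (\<phi> x)) (real m) (vpoint (\<phi> y))"
        using relpow_imp_pl_joined[OF sG' m(2)] \<phi>(1) xy by simp
      ultimately show ?thesis
        using point_dist_le by (meson ereal_less_eq(3) order_trans)
    qed
    assume "\<not> ?lhs \<le> ?rhs"
    \<comment> \<open>A real number strictly between the two sides, solved for the distance, shows
      that this distance is finite and yields a path to which \<open>bound\<close> applies.\<close>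
    then obtain z where z: "?rhs < ereal z" "ereal z < ?lhs"
      using ereal_dense2[of ?rhs ?lhs] by (auto simp: not_le)
    have "point_dist G x y < ereal ((z - real K) / real K)"
    proof (cases "point_dist G x y")
      case (real r)
      then have "real K * r + real K < z" using z(1) by simp
      then show ?thesis using real K1 by (simp add: field_simps)
    next
      case PInf
      then show ?thesis using z(1) K1 by simp
    qed simp
    then obtain L where L: "pl_joined G x L y" "L < (z - real K) / real K"
      by (auto simp: point_dist_less_iff)
    then have "real K * L + real K \<le> z" using K1 by (simp add: field_simps)
    then show False using bound[OF L(1)] z(2) by (meson ereal_less_eq(3) leD order_trans)
  qed
  have dense: "\<exists>x\<in>points G. point_dist ?G' z (vpoint (\<phi> x)) \<le> ereal (real K)"
    if z: "z \<in> points ?G'" for z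
  proof -
    obtain v where v: "v \<in> verts G" "z v \<ge> 1/2" using points_half[OF sG' z] by auto
    have p: "vpoint v \<in> points G" using v by (rule_tac vpoint_in_points)
    \<comment> \<open>Only the coordinate at \<open>v\<close> is non-zero, so the choice in
      \<open>\<phi>\<close> is forced.\<close>
    have "\<phi> (vpoint v) = v" using \<phi>(2)[OF p] by (auto simp: vpoint_def split: if_splits)
    moreover have "pl_joined ?G' z (1 - z v) (vpoint v)"
      using pl_joined_vpoint[OF sG' z] v by simp
    then have "point_dist ?G' z (vpoint v) \<le> ereal (real K)"
      using point_dist_le v(2) K1 by (smt (verit) ereal_less_eq(3) order_trans field_sum_of_halves)
    ultimately show ?thesis using p by (metis (no_types))
  qed
  show ?thesis
    unfolding quasi_isometric_def quasi_isometry_def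
    using \<phi>(1) lower upper dense by (intro exI[of _ \<phi>]) auto
qed

section \<open>Cores of path-connected sets\<close>

text \<open>A coordinate above 1/2 at \<open>v\<close> means distance below 1/2 from
  \<open>v\<close>. The strictness later raises the distance of two such vertices from at least 2 to
  at least 3.\<close>

definition core :: "'a point set \<Rightarrow> 'a set" where
  "core X = {v. \<exists>x\<in>X. x v > 1/2}"

text \<open>Among non-empty path-connected sets of points of a simple graph, these are exactly the
  ones with empty core.\<close>

definition midpoint_singleton :: "'a point set \<Rightarrow> bool" where
  "midpoint_singleton X \<longleftrightarrow> (\<exists>x. X = {x} \<and> (\<forall>v. x v \<le> 1/2))"

text \<open>A local-to-global principle: pulled back along a path in \<open>X\<close>, the classes
  of \<open>R\<close> are open in the unit interval, which is connected, so there is only one class.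
  The short paths in the last assumption may leave \<open>X\<close>.\<close>

lemma path_connectedin_chain:
  assumes "path_connectedin (graph_topology G) X" "x \<in> X" "y \<in> X" "r > 0"
    and refl: "\<And>x. x \<in> X \<Longrightarrow> R x x"
    and sym: "\<And>x y. x \<in> X \<Longrightarrow> y \<in> X \<Longrightarrow> R x y \<Longrightarrow> R y x"
    and trans: "\<And>x y z. x \<in> X \<Longrightarrow> y \<in> X \<Longrightarrow> z \<in> X \<Longrightarrow> R x y \<Longrightarrow> R y z \<Longrightarrow> R x z"
    and near: "\<And>x y L. x \<in> X \<Longrightarrow> y \<in> X \<Longrightarrow> pl_joined G x L y \<Longrightarrow> L < r \<Longrightarrow> R x y"
  shows "R x y"
proof -
  obtain g where g: "pathin (graph_topology G) g" "g ` {0..1} \<subseteq> X" "g 0 = x" "g 1 = y"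
    using assms(1-3) unfolding path_connectedin image_subset_iff_funcset by metis
  have gX: "g t \<in> X" if "t \<in> {0..1}" for t using g(2) that by auto
  have XG: "X \<subseteq> points G"
    using path_connectedin_subset_topspace[OF assms(1)] by (simp add: topspace_graph_topology)
  have "R (g 0) (g 1)"
  proof (rule connected_equivalence_relation[of "{0..1::real}" 0 1 "\<lambda>s t. R (g s) (g t)"])
    fix t :: real assume t: "t \<in> {0..1}"
    define T where "T = {s \<in> {0..1}. g s \<in> {y \<in> points G. point_dist G (g t) y < ereal r}}"
    have "openin (top_of_set {0..1}) T"
      using g(1) openin_graph_ball[of G "g t" r] unfolding T_def pathin_def continuous_map_def by auto
    moreover have "t \<in> T"
    proof -
      have "pl_joined G (g t) 0 (g t)" using gX[OF t] XG by (intro pl_joined.refl) auto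
      then show ?thesis
        using t gX[OF t] XG \<open>r > 0\<close> by (auto simp: T_def point_dist_less_iff intro!: exI[of _ 0])
    qed
    moreover have "R (g t) (g s)" if "s \<in> T" for s
      using that near gX t by (auto simp: T_def point_dist_less_iff)
    ultimately show "\<exists>T. openin (top_of_set {0..1}) T \<and> t \<in> T \<and> (\<forall>s\<in>T. R (g t) (g s))" by auto
  next
    fix s t u :: real
    assume "R (g s) (g t)" "R (g t) (g u)" "s \<in> {0..1}" "t \<in> {0..1}" "u \<in> {0..1}"
    then show "R (g s) (g u)" using trans gX by metis
  next
    fix s t :: real
    assume "R (g s) (g t)" "s \<in> {0..1}" "t \<in> {0..1}"
    then show "R (g t) (g s)" using sym gX by metis
  qed auto
  then show ?thesis using g by simp
qed

text \<open>A set that reaches the midpoint of an edge without being that midpoint must contain points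
  strictly closer to one of the two ends.\<close>

lemma half_in_core:
  assumes "simple_graph G" "path_connectedin (graph_topology G) X" "\<not> midpoint_singleton X" "x \<in> X"
  obtains a where "a \<in> core X" "x a \<ge> 1/2"
proof (cases "\<exists>a. x a > 1/2")
  case True
  then show ?thesis using that assms(4) by (force simp: core_def)
next
  case False
  have XG: "X \<subseteq> points G"
    using path_connectedin_subset_topspace[OF assms(2)] by (simp add: topspace_graph_topology)
  obtain a where a: "x a = 1/2"
    using points_half[OF assms(1), of x] XG assms(4) False by (metis leI order_antisym subsetD)
  have xG: "x \<in> points G" using XG assms(4) by auto
  obtain b where b: "b \<noteq> a" "x b = 1/2"
    using assms(1) xG
  proof (cases rule: points_cases)
    case (1 v)
    then have "a = v" "x v = 1" using a by (auto simp: vpoint_def split: if_splits)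
    then show ?thesis using a by simp
  next
    case (2 u v)
    note e = edge_points_pairD[OF 2(5,3)]
    have "a \<in> {u, v}" using e(4)[of a] a by auto
    then show ?thesis using e(1) a that[of u] that[of v] 2(3) by auto
  qed
  have "a \<in> core X \<or> b \<in> core X"
  proof (rule ccontr)
    assume *: "\<not> (a \<in> core X \<or> b \<in> core X)"
    \<comment> \<open>A nearby point keeps both coordinates positive, so it lies on the edge of
      \<open>a\<close> and \<open>b\<close>. Outside the core both are at most 1/2, and their sum 1
      forces the midpoint.\<close>
    have near: "y = x" if y: "y \<in> X" "pl_joined G x L y" "L < 1/2" for y L
    proof -
      have "y a > 0" "y b > 0"
        using pl_joined_coord[OF assms(1) y(2), of a] pl_joined_coord[OF assms(1) y(2), of b] a b y(3)
        by linarith+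
      then have ye: "y \<in> edge_points {a, b}" using points_two_pos[OF assms(1)] y(1) XG b(1) by blast
      have xe: "x \<in> edge_points {a, b}"
        using points_two_pos[OF assms(1), of x a b] assms(4) XG a b by auto
      have "y a \<le> 1/2" "y b \<le> 1/2" using * y(1) by (auto simp: core_def not_less)
      then have "y a = 1/2" "y b = 1/2" using edge_points_pairD(1)[OF ye] b(1) by auto
      then show ?thesis
        using a b edge_points_pairD(4)[OF ye] edge_points_pairD(4)[OF xe] by (metis ext)
    qed
    \<comment> \<open>The relation has \<open>{x}\<close> and its complement in \<open>X\<close> as
      classes. Both are closed under short paths, so the complement is empty.\<close>
    have "x = x \<longleftrightarrow> y = x" if "y \<in> X" for y
    proof (rule path_connectedin_chain[OF assms(2,4) that, of "1/2" "\<lambda>y z. y = x \<longleftrightarrow> z = x"])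
      show "y = x \<longleftrightarrow> z = x" if "y \<in> X" "z \<in> X" "pl_joined G y L z" "L < 1/2" for y z L
        using near[of z L] near[of y L] pl_joined_sym[OF that(3)] that by auto
    qed auto
    then have "X = {x}" using assms(4) by blast
    then show False using assms(3) False by (auto simp: midpoint_singleton_def not_less)
  qed
  then show ?thesis using that a b by auto
qed

text \<open>Points of \<open>X\<close> are related if core vertices near the one and near the other
  are always linked inside the core. Points closer than 1/2 are related because both vertices have
  positive coordinates at the second point, hence are equal or adjacent.\<close>

lemma core_connected:
  assumes "simple_graph G" "path_connectedin (graph_topology G) X" "p \<in> core X" "q \<in> core X"
  shows "(p, q) \<in> (adj G \<inter> core X \<times> core X)\<^sup>*"
proof (cases "midpoint_singleton X")
  case True
  then have "core X = {}" by (auto simp: midpoint_singleton_def core_def not_less)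
  then show ?thesis using assms(3) by simp
next
  case False
  let ?C = "adj G \<inter> core X \<times> core X"
  \<comment> \<open>The threshold includes 1/2, since a midpoint in \<open>X\<close> has no vertex
    nearer than its two ends.\<close>
  define R where "R x y \<longleftrightarrow> (\<forall>v\<in>core X. \<forall>w\<in>core X. x v \<ge> 1/2 \<longrightarrow> y w \<ge> 1/2 \<longrightarrow> (v, w) \<in> ?C\<^sup>*)"
    for x y :: "'a point"
  have XG: "X \<subseteq> points G"
    using path_connectedin_subset_topspace[OF assms(2)] by (simp add: topspace_graph_topology)
  have near: "R x y" if xy: "x \<in> X" "y \<in> X" "pl_joined G x L y" "L < 1/2" for x y L
    unfolding R_def
  proof (intro ballI impI)
    fix v w assume vw: "v \<in> core X" "w \<in> core X" "x v \<ge> 1/2" "y w \<ge> 1/2"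
    show "(v, w) \<in> ?C\<^sup>*"
    proof (cases "v = w")
      case False
      have "y v > 0" using pl_joined_coord[OF assms(1) xy(3), of v] xy(4) vw(3) by linarith
      then have "{v, w} \<in> edges G"
        using points_two_pos(1)[OF assms(1) _ _ _ False] xy(2) XG vw(4) by force
      then show ?thesis using vw by (auto simp: adj_def)
    qed simp
  qed
  obtain x y where xy: "x \<in> X" "x p > 1/2" "y \<in> X" "y q > 1/2"
    using assms(3,4) by (auto simp: core_def)
  have "R x y"
  proof (rule path_connectedin_chain[OF assms(2) xy(1,3), of "1/2"])
    show "R x x" if "x \<in> X" for x
      using near[OF that that pl_joined.refl] that XG by auto
    have "sym ?C" using adj_sym[of G] by (auto simp: sym_def)
    then have "sym (?C\<^sup>*)" by (rule sym_rtrancl)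
    then show "R y x" if "R x y" for x y using that unfolding R_def by (meson symE)
    show "R x z" if y: "y \<in> X" and "R x y" "R y z" for x y z
    proof -
      \<comment> \<open>Transitivity needs a core vertex near the middle point; it exists because
        \<open>X\<close> is not a single midpoint.\<close>
      obtain a where "a \<in> core X" "y a \<ge> 1/2" using half_in_core[OF assms(1,2) False y] .
      then show ?thesis using that unfolding R_def by (meson rtrancl_trans)
    qed
  qed (use near in auto)
  then show ?thesis using xy assms(3,4) by (auto simp: R_def)
qed

section \<open>Thickenings: path-connectedness and separation\<close>

definition thicken :: "'a graph \<Rightarrow> 'a set \<Rightarrow> real \<Rightarrow> 'a point set" where
  "thicken G A r = (\<Union>p\<in>A. pl_cball G p r)"

text \<open>A walk of at most \<open>K\<close> edges is split at a middle vertex; the longer half,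
  rounded up, still has length at most \<open>(K + 1) / 2\<close>. This fixes the radius used
  throughout.\<close>

lemma pl_cballs_overlap:
  assumes "simple_graph G" "(p, q) \<in> adj (power_graph K G)"
  shows "pl_cball G p ((real K + 1) / 2) \<inter> pl_cball G q ((real K + 1) / 2) \<noteq> {}"
proof -
  obtain n where n: "n \<le> K" "(p, q) \<in> adj G ^^ n" and pq: "p \<in> verts G" "q \<in> verts G"
    using assms(2) by (auto simp: adj_power_graph_iff)
  have "n = n div 2 + (n - n div 2)" by simp
  then obtain w where w: "(p, w) \<in> adj G ^^ (n div 2)" "(w, q) \<in> adj G ^^ (n - n div 2)"
    using n(2) by (metis relpow_add relcompE prod.inject)
  have "2 * (n div 2) \<le> K + 1" "2 * (n - n div 2) \<le> K + 1" using n(1) by linarith+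
  then have "real (2 * (n div 2)) \<le> real (K + 1)" "real (2 * (n - n div 2)) \<le> real (K + 1)"
    by (simp_all only: of_nat_le_iff)
  then have "real (n div 2) \<le> (real K + 1) / 2" "real (n - n div 2) \<le> (real K + 1) / 2"
    by simp_all
  then have "vpoint w \<in> pl_cball G p ((real K + 1) / 2) \<inter> pl_cball G q ((real K + 1) / 2)"
    using relpow_imp_pl_joined[OF assms(1) w(1) pq(1)]
      relpow_imp_pl_joined[OF assms(1) relpow_adj_sym[OF w(2)] pq(2)]
    unfolding pl_cball_def by blast
  then show ?thesis by auto
qed

text \<open>Each ball lies in the path component of its centre, and overlapping balls share a
  component. The relation \<open>E\<close> is either adjacency in the power graph within a core or
  empty for a single centre.\<close>

lemma path_connectedin_thicken:
  assumes "simple_graph G" "A \<subseteq> verts G"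
    and conn: "\<And>p q. p \<in> A \<Longrightarrow> q \<in> A \<Longrightarrow> (p, q) \<in> E\<^sup>*" and "E \<subseteq> A \<times> A"
    and overlap: "\<And>p q. (p, q) \<in> E \<Longrightarrow> pl_cball G p r \<inter> pl_cball G q r \<noteq> {}"
  shows "path_connectedin (graph_topology G) (thicken G A r)"
proof -
  let ?S = "thicken G A r"
  let ?C = "path_component_of (subtopology (graph_topology G) ?S)"
  have S: "?S \<subseteq> points G" by (auto simp: thicken_def pl_cball_def dest: pl_joined_in_points)
  have centre: "?C (vpoint p) z" if "p \<in> A" "z \<in> pl_cball G p r" for p z
    by (rule path_component_of_cball[OF assms(1) that(2)]) (use that in \<open>auto simp: thicken_def\<close>)
  have edge: "?C (vpoint p) (vpoint q)" if pq: "(p, q) \<in> E" for p q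
  proof -
    obtain z where "z \<in> pl_cball G p r" "z \<in> pl_cball G q r" using overlap[OF pq] by auto
    moreover have "p \<in> A" "q \<in> A" using pq \<open>E \<subseteq> A \<times> A\<close> by auto
    ultimately have "?C (vpoint p) z" "?C z (vpoint q)"
      using centre path_component_of_sym[OF centre] by simp_all
    then show ?thesis by (rule path_component_of_trans)
  qed
  \<comment> \<open>For negative \<open>r\<close> balls are empty, so reflexivity at the start is a
    premise here; below it comes from going to a point of the ball and back.\<close>
  have chain: "?C (vpoint p) (vpoint q)"
    if "(p, q) \<in> E\<^sup>*" "?C (vpoint p) (vpoint p)" for p q
    using that
  proof (induction rule: rtrancl_induct)
    case (step q s)
    show ?case by (rule path_component_of_trans[OF step.IH[OF step.prems] edge[OF step.hyps(2)]])
  qed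
  have "?C x y" if xy: "x \<in> ?S" "y \<in> ?S" for x y
  proof -
    obtain p q where pq: "p \<in> A" "x \<in> pl_cball G p r" "q \<in> A" "y \<in> pl_cball G q r"
      using xy by (auto simp: thicken_def)
    have px: "?C (vpoint p) x" using centre pq by auto
    then have xp: "?C x (vpoint p)" by (rule path_component_of_sym)
    have "?C (vpoint p) (vpoint q)"
      using chain[OF conn[OF pq(1,3)] path_component_of_trans[OF px xp]] .
    then show ?thesis
      by (rule path_component_of_trans[OF xp path_component_of_trans[OF _ centre[OF pq(3,4)]]])
  qed
  then show ?thesis using S
    by (auto simp: path_connectedin_def path_connected_space_iff_path_component topspace_graph_topology)
qed

text \<open>The walk, extended to \<open>x\<close> and \<open>y\<close>, has length
  \<open>(1 - x a) + m + (1 - y c)\<close>, which is at least 3. Each end piece is at most 1/2; if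
  one is shorter, \<open>m\<close> exceeds 2.\<close>

lemma relpow_lower_of_far:
  assumes "simple_graph G" "ereal 3 \<le> set_dist G X Y" "X \<subseteq> points G" "Y \<subseteq> points G"
    and "x \<in> X" "x a \<ge> 1/2" "y \<in> Y" "y c \<ge> 1/2" and m: "(a, c) \<in> adj G ^^ m"
  shows "m \<ge> 2" and "x a > 1/2 \<or> y c > 1/2 \<Longrightarrow> m \<ge> 3"
proof -
  have "x a > 0" "y c > 0" using assms by linarith+
  then have j: "pl_joined G x (1 - x a) (vpoint a)" "pl_joined G y (1 - y c) (vpoint c)"
    and "a \<in> verts G"
    using pl_joined_vpoint[OF assms(1)] points_pos_in_verts[OF assms(1)] assms(3-8) by blast+
  then have "pl_joined G (vpoint a) (real m) (vpoint c)"
    using relpow_imp_pl_joined[OF assms(1) m] by blast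
  from pl_joined_trans[OF pl_joined_trans[OF pl_joined_sym[OF j(2)] this] j(1)]
  have "3 \<le> 1 - x a + (real m + (1 - y c))" using assms(2,5,7) by (auto simp: le_set_dist_iff)
  then show "m \<ge> 2" "x a > 1/2 \<or> y c > 1/2 \<Longrightarrow> m \<ge> 3" using assms(6,8) by linarith+
qed

text \<open>A coordinate \<open>x a \<ge> 1/2\<close> means that \<open>a\<close> is within distance \<open>1/2\<close> of \<open>x\<close>.  Equality is
  allowed only for balls of radius \<open>0\<close>, where the weaker bound \<open>K + 1\<close> on the distance of the
  centres suffices.\<close>

definition centres :: "nat \<Rightarrow> 'a point set \<Rightarrow> 'a set \<Rightarrow> real \<Rightarrow> bool" where
  "centres K X A r \<longleftrightarrow> r \<le> (real K + 1) / 2 \<and>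
     (\<forall>a\<in>A. \<exists>x\<in>X. x a \<ge> 1/2 \<and> (x a > 1/2 \<or> r \<le> 0))"

lemma centres_core: "centres K X (core X) ((real K + 1) / 2)"
  by (force simp: centres_def core_def)

text \<open>A path of length \<open>L\<close> between the thickenings gives a walk in
  \<open>G\<close> between centres of length at most \<open>r + L + s\<close>. If one coordinate
  exceeds 1/2, this walk has at least \<open>2 * K + 1\<close> edges and
  \<open>r + s \<le> K + 1\<close>; otherwise it has more than \<open>K\<close> edges and both radii
  are at most 0.\<close>

lemma set_dist_thicken:
  assumes "simple_graph G" "ereal 3 \<le> set_dist (power_graph K G) X Y"
    and "X \<subseteq> points (power_graph K G)" "Y \<subseteq> points (power_graph K G)"
    and "centres K X A r" "centres K Y C s"
  shows "ereal (real K) \<le> set_dist G (thicken G A r) (thicken G C s)"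
  unfolding le_set_dist_iff
proof (intro ballI allI impI)
  let ?G' = "power_graph K G"
  have sG': "simple_graph ?G'" by (rule simple_graph_power_graph)
  fix z z' L assume "z \<in> thicken G A r" "z' \<in> thicken G C s" and L: "pl_joined G z L z'"
  then obtain a c M N where a: "a \<in> A" "M \<le> r" "pl_joined G (vpoint a) M z"
    and c: "c \<in> C" "N \<le> s" "pl_joined G (vpoint c) N z'"
    by (auto simp: thicken_def pl_cball_def)
  obtain x y where x: "x \<in> X" "x a \<ge> 1/2" "x a > 1/2 \<or> r \<le> 0"
    and y: "y \<in> Y" "y c \<ge> 1/2" "y c > 1/2 \<or> s \<le> 0"
    using assms(5,6) a(1) c(1) unfolding centres_def by meson
  have rs: "r \<le> (real K + 1) / 2" "s \<le> (real K + 1) / 2"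
    using assms(5,6) by (auto simp: centres_def)
  have av: "a \<in> verts G" using points_pos_in_verts[OF sG', of x a] x assms(3) by auto
  obtain n where n: "(a, c) \<in> adj G ^^ n" "real n \<le> M + (L + N)"
    using pl_joined_imp_relpow[OF assms(1)
        pl_joined_trans[OF pl_joined_trans[OF pl_joined_sym[OF c(3)] L] a(3)]] by blast
  note far = relpow_lower_of_far[OF sG' assms(2-4) x(1,2) y(1,2)]
  show "real K \<le> L"
  proof (cases "x a > 1/2 \<or> y c > 1/2")
    case True
    have "\<not> n \<le> K * 2"
      using relpow_power_graph[OF assms(1) n(1) av, of K 2] far(2)[OF _ True] by fastforce
    then have "real n \<ge> 2 * real K + 1" by linarith
    moreover have "r + s \<le> real K + 1" using rs by (simp add: field_simps)
    ultimately show ?thesis using n(2) a(2) c(2) by linarith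
  next
    case False
    have "\<not> n \<le> K * 1"
      using relpow_power_graph[OF assms(1) n(1) av, of K 1] far(1) by fastforce
    then have "real n \<ge> real K" by linarith
    then show ?thesis using n(2) a(2) c(2) x(3) y(3) False by linarith
  qed
qed

section \<open>Transfer of fat minor models to the original graph\<close>

lemma fat_minor_of_power_graph:
  assumes "simple_graph G" "simple_graph H" "fat_minor 3 H (power_graph K G)"
  shows "fat_minor K H G"
proof -
  let ?G' = "power_graph K G"
  let ?r = "(real K + 1) / 2"
  have sG': "simple_graph ?G'" by (rule simple_graph_power_graph)
  obtain B P where BP: "fat_minor_model 3 H ?G' B P" using assms(3) by (auto simp: fat_minor_def)
  have Bne: "B v \<noteq> {}" and Bpc: "path_connectedin (graph_topology ?G') (B v)"
    if "v \<in> verts H" for v using BP that by (auto simp: fat_minor_model_def)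
  have Ppc: "path_connectedin (graph_topology ?G') (P e)" if "e \<in> edges H" for e
    using BP that by (auto simp: fat_minor_model_def)
  have BPne: "B v \<inter> P e \<noteq> {}" if "e \<in> edges H" "v \<in> e" for v e
    using BP that by (auto simp: fat_minor_model_def)
  have BB: "ereal 3 \<le> set_dist ?G' (B u) (B v)" if "u \<in> verts H" "v \<in> verts H" "u \<noteq> v" for u v
    using BP that by (auto simp: fat_minor_model_def)
  have PP: "ereal 3 \<le> set_dist ?G' (P e) (P f)" if "e \<in> edges H" "f \<in> edges H" "e \<noteq> f" for e f
    using BP that by (auto simp: fat_minor_model_def)
  have BPfar: "ereal 3 \<le> set_dist ?G' (B v) (P e)" if "v \<in> verts H" "e \<in> edges H" "v \<notin> e" for v e
    using BP that by (auto simp: fat_minor_model_def)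
  have Bpts: "B v \<subseteq> points ?G'" if "v \<in> verts H" for v
    using path_connectedin_subset_topspace[OF Bpc[OF that]] by (simp add: topspace_graph_topology)
  have Ppts: "P e \<subseteq> points ?G'" if "e \<in> edges H" for e
    using path_connectedin_subset_topspace[OF Ppc[OF that]] by (simp add: topspace_graph_topology)
  have disjoint: False if "ereal 3 \<le> set_dist ?G' X Y" "x \<in> X" "x \<in> Y" "x \<in> points ?G'" for X Y x
    using that pl_joined.refl[of x ?G'] by (force simp: le_set_dist_iff)
  have He: "v \<in> verts H" if "e \<in> edges H" "v \<in> e" for e v
    using simple_graph_edgeE[OF assms(2) that(1)] that(2) by blast
  \<comment> \<open>An edge set meets the branch sets of both ends, which are disjoint, so it cannot
    be a single point.\<close>
  have Pms: "\<not> midpoint_singleton (P e)" if e: "e \<in> edges H" for e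
  proof
    assume "midpoint_singleton (P e)"
    then obtain x where x: "P e = {x}" by (auto simp: midpoint_singleton_def)
    obtain u v where uv: "u \<in> verts H" "v \<in> verts H" "u \<noteq> v" "e = {u, v}"
      using simple_graph_edgeE[OF assms(2) e] .
    have "x \<in> B u" "x \<in> B v" using BPne[OF e] uv x by auto
    then show False using disjoint[OF BB[OF uv(1-3)]] Bpts[OF uv(1)] by auto
  qed
  have rep: "\<exists>a. (\<exists>x\<in>B v. x a \<ge> 1/2) \<and> (\<forall>e\<in>edges H. v \<in> e \<longrightarrow> a \<in> core (P e))"
    if v: "v \<in> verts H" "midpoint_singleton (B v)" for v
  proof -
    obtain x where x: "B v = {x}" using v(2) by (auto simp: midpoint_singleton_def)
    have xp: "x \<in> points ?G'" using Bpts[OF v(1)] x by auto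
    show ?thesis
    proof (cases "\<exists>e\<in>edges H. v \<in> e")
      case True
      then obtain e where e: "e \<in> edges H" "v \<in> e" by auto
      have xP: "x \<in> P f" if "f \<in> edges H" "v \<in> f" for f using BPne[OF that] x by auto
      \<comment> \<open>The sets of all edges at \<open>v\<close> contain the one point of
        \<open>B v\<close>, but sets of distinct edges are disjoint, so \<open>v\<close> has degree
        at most one.\<close>
      have "f = e" if "f \<in> edges H" "v \<in> f" for f
        using disjoint[OF PP[OF that(1) e(1)] xP[OF that] xP[OF e] xp] by blast
      moreover obtain a where "a \<in> core (P e)" "x a \<ge> 1/2"
        using half_in_core[OF sG' Ppc Pms xP] e by metis
      ultimately show ?thesis using x by auto
    next
      case False
      then show ?thesis using points_half[OF sG' xp] x by (metis singletonI)
    qed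
  qed
  then obtain a where a: "\<And>v. v \<in> verts H \<Longrightarrow> midpoint_singleton (B v) \<Longrightarrow>
      (\<exists>x\<in>B v. x (a v) \<ge> 1/2) \<and> (\<forall>e\<in>edges H. v \<in> e \<longrightarrow> a v \<in> core (P e))"
    by metis
  define W where "W v = (if midpoint_singleton (B v) then {a v} else core (B v))" for v
  define r where "r v = (if midpoint_singleton (B v) then 0 else ?r)" for v
  \<comment> \<open>The vertex \<open>a v\<close> may have coordinate exactly 1/2, which
    \<open>centres\<close> permits because the radius is 0.\<close>
  have Wc: "centres K (B v) (W v) (r v)" if "v \<in> verts H" for v
    using a[OF that] centres_core[of K "B v"] by (auto simp: W_def r_def centres_def)
  have r0: "0 \<le> r v" for v by (simp add: r_def)
  have centres_verts: "A \<subseteq> verts G" if "centres K X A s" "X \<subseteq> points ?G'" for X A s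
    using that points_pos_in_verts[OF sG'] unfolding centres_def
    by (smt (verit) divide_pos_pos subset_iff verts_power_graph)
  note Wv = centres_verts[OF Wc Bpts]
  have Pv: "core (P e) \<subseteq> verts G" if "e \<in> edges H" for e
    using centres_verts[OF centres_core Ppts[OF that]] .
  have Wne: "W v \<noteq> {}" if v: "v \<in> verts H" for v
    using half_in_core[OF sG' Bpc[OF v]] Bne[OF v] by (auto simp: W_def)
  have pc_core: "path_connectedin (graph_topology G) (thicken G (core X) ?r)"
    if X: "path_connectedin (graph_topology ?G') X" "core X \<subseteq> verts G" for X
    by (rule path_connectedin_thicken[OF assms(1) X(2) core_connected[OF sG' X(1)]])
      (use pl_cballs_overlap[OF assms(1)] in auto)
  have "fat_minor_model K H G (\<lambda>v. thicken G (W v) (r v)) (\<lambda>e. thicken G (core (P e)) ?r)"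
    unfolding fat_minor_model_def
  proof (intro conjI ballI impI)
    fix v assume v: "v \<in> verts H"
    show "thicken G (W v) (r v) \<noteq> {}"
      using Wne[OF v] Wv[OF v v] pl_cball_center[OF _ r0, of _ G v] by (fastforce simp: thicken_def)
    show "path_connectedin (graph_topology G) (thicken G (W v) (r v))"
    proof (cases "midpoint_singleton (B v)")
      case True
      then show ?thesis using Wv[OF v v]
        by (intro path_connectedin_thicken[OF assms(1), of _ "{}"]) (auto simp: W_def)
    next
      case False
      then show ?thesis using pc_core[OF Bpc[OF v]] Wv[OF v v] by (simp add: W_def r_def)
    qed
  next
    fix e assume "e \<in> edges H"
    then show "path_connectedin (graph_topology G) (thicken G (core (P e)) ?r)"
      using pc_core Ppc Pv by blast
  next
    fix e v assume e: "e \<in> edges H" "v \<in> e"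
    have v: "v \<in> verts H" using He e .
    show "thicken G (W v) (r v) \<inter> thicken G (core (P e)) ?r \<noteq> {}"
    proof (cases "midpoint_singleton (B v)")
      case True
      \<comment> \<open>By its choice \<open>a v\<close> is a centre for both sets, so even the ball
        of radius 0 meets the thickened edge set.\<close>
      then have "a v \<in> core (P e)" "a v \<in> W v" using a[OF v] e by (auto simp: W_def)
      then have "vpoint (a v) \<in> thicken G (W v) (r v)" "vpoint (a v) \<in> thicken G (core (P e)) ?r"
        using Pv[OF e(1)] pl_cball_center[of "a v" G ?r] pl_cball_center[of "a v" G "r v"] r0[of v]
        unfolding thicken_def by auto
      then show ?thesis by auto
    next
      case False
      obtain x where x: "x \<in> B v" "x \<in> P e" using BPne[OF e] by auto
      obtain b where b: "b \<in> core (B v)" "x b \<ge> 1/2" using half_in_core[OF sG' Bpc[OF v] False x(1)] .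
      obtain c where c: "c \<in> core (P e)" "x c \<ge> 1/2"
        using half_in_core[OF sG' Ppc[OF e(1)] Pms[OF e(1)] x(2)] .
      \<comment> \<open>Both \<open>b\<close> and \<open>c\<close> have positive coordinates at the
        common point \<open>x\<close>, so they are equal or adjacent in the power graph.\<close>
      have "pl_cball G b ?r \<inter> pl_cball G c ?r \<noteq> {}"
      proof (cases "b = c")
        case True
        then show ?thesis using pl_cball_center[of c G ?r] c(1) Pv[OF e(1)] by auto
      next
        case False
        then have "(b, c) \<in> adj ?G'"
          using points_two_pos(1)[OF sG', of x b c] Bpts[OF v] x b c by (auto simp: adj_def)
        then show ?thesis by (rule pl_cballs_overlap[OF assms(1)])
      qed
      then show ?thesis using b c False by (auto simp: thicken_def W_def r_def)
    qed
  next
    fix u v assume "u \<in> verts H" "v \<in> verts H" "u \<noteq> v"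
    then show "ereal (real K) \<le> set_dist G (thicken G (W u) (r u)) (thicken G (W v) (r v))"
      using set_dist_thicken[OF assms(1) BB Bpts Bpts Wc Wc] by blast
  next
    fix e f assume "e \<in> edges H" "f \<in> edges H" "e \<noteq> f"
    then show "ereal (real K) \<le> set_dist G (thicken G (core (P e)) ?r) (thicken G (core (P f)) ?r)"
      using set_dist_thicken[OF assms(1) PP Ppts Ppts centres_core centres_core] by blast
  next
    fix v e assume "v \<in> verts H" "e \<in> edges H" "v \<notin> e"
    then show "ereal (real K) \<le> set_dist G (thicken G (W v) (r v)) (thicken G (core (P e)) ?r)"
      using set_dist_thicken[OF assms(1) BPfar Bpts Ppts Wc centres_core] by blast
  qed
  then show ?thesis by (auto simp: fat_minor_def)
qed

theorem theorem3:
  fixes K :: nat and \<H> :: "'b graph set" and G :: "'a graph"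
  assumes "K > 0"
    and "\<H> \<noteq> {}"
    and "\<forall>H\<in>\<H>. simple_graph H"
    and "simple_graph G"
    and "\<forall>H\<in>\<H>. \<not> fat_minor K H G"
  shows "\<exists>G' :: 'a graph. simple_graph G' \<and> quasi_isometric K G G' \<and>
           (\<forall>H\<in>\<H>. \<not> fat_minor 3 H G')"
  using assms simple_graph_power_graph[of K G] quasi_isometric_power_graph[of G K]
    fat_minor_of_power_graph[of G _ K] by blast

end
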